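(* Let $G$ and $H$ be finite undirected graphs (multiple edges and loops allowed). Then the inverse semigroups $\mathrm{Fisg}(G)$ and $\mathrm{Fisg}(H)$ are isomorphic as semigroups if and only if $G$ and $H$ are isomorphic as graphs.
   Context: Graphs are finite and undirected and may have multiple edges and loops; the empty graph $\emptyset$ (no vertices, no edges) counts as a graph, and the empty map $\mu_0:\emptyset\to\emptyset$ counts as a graph isomorphism. A graph isomorphism consists of a bijection on vertices and a bijection on edges preserving incidence. For a graph $G$, $\mathrm{Fisg}(G)$ is the set of all graph isomorphisms $\varphi:H\to J$ where $H$ and $J$ are subgraphs of $G$ (not necessarily induced). For $\varphi,\psi\in\mathrm{Fisg}(G)$ the product $\psi\circ\varphi$ is the composition of partial maps: it has domain $\varphi^{-1}(\mathrm{Im}(\varphi)\cap\mathrm{Dom}(\psi))$, image $\psi(\mathrm{Im}(\varphi)\cap\mathrm{Dom}(\psi))$, and is given by applying $\varphi$ and then $\psi$. With this product $\mathrm{Fisg}(G)$ is an inverse semigroup. *)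

theory Defs
  imports "HOL-Algebra.Group"
begin

text \<open>
  Undirected multigraphs: vertices and edges are separate sets, and each edge carries the set of
  its endpoints, which is a singleton exactly for loops. The value of \<open>ends\<close> outside \<open>edges\<close> is
  irrelevant.
\<close>

record ('v, 'e) ugraph =
  verts :: "'v set"
  edges :: "'e set"
  ends :: "'e \<Rightarrow> 'v set"

definition graph :: "('v, 'e) ugraph \<Rightarrow> bool" where
  "graph G \<longleftrightarrow> finite (verts G) \<and> finite (edges G) \<and>
     (\<forall>e\<in>edges G. ends G e \<subseteq> verts G \<and> card (ends G e) \<in> {1, 2})"

definition graph_isomorphism ::
  "('v, 'e) ugraph \<Rightarrow> ('w, 'f) ugraph \<Rightarrow> ('v \<Rightarrow> 'w) \<Rightarrow> ('e \<Rightarrow> 'f) \<Rightarrow> bool" where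
  "graph_isomorphism G H f g \<longleftrightarrow>
     bij_betw f (verts G) (verts H) \<and> bij_betw g (edges G) (edges H) \<and>
     (\<forall>v\<in>verts G. \<forall>e\<in>edges G. v \<in> ends G e \<longleftrightarrow> f v \<in> ends H (g e))"

definition graph_isomorphic :: "('v, 'e) ugraph \<Rightarrow> ('w, 'f) ugraph \<Rightarrow> bool" where
  "graph_isomorphic G H \<longleftrightarrow> (\<exists>f g. graph_isomorphism G H f g)"

definition subgraph :: "('v, 'e) ugraph \<Rightarrow> ('v, 'e) ugraph \<Rightarrow> bool" where
  "subgraph H G \<longleftrightarrow> graph H \<and> verts H \<subseteq> verts G \<and> edges H \<subseteq> edges G \<and>
     (\<forall>e\<in>edges H. ends H e = ends G e)"

text \<open>
  An isomorphism between subgraphs is stored as a pair of partial maps, one on vertices and one on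
  edges, so that its domain and image are part of the data and two isomorphisms are equal iff they
  have the same domain and the same values.
\<close>

type_synonym ('v, 'e) partial_map = "('v \<rightharpoonup> 'v) \<times> ('e \<rightharpoonup> 'e)"

definition fisg_carrier :: "('v, 'e) ugraph \<Rightarrow> ('v, 'e) partial_map set" where
  "fisg_carrier G = {((Some \<circ> f) |` verts H, (Some \<circ> g) |` edges H) | H J f g.
     subgraph H G \<and> subgraph J G \<and> graph_isomorphism H J f g}"

definition pcomp ::
  "('v, 'e) partial_map \<Rightarrow> ('v, 'e) partial_map \<Rightarrow> ('v, 'e) partial_map" where
  "pcomp \<psi> \<phi> = (fst \<psi> \<circ>\<^sub>m fst \<phi>, snd \<psi> \<circ>\<^sub>m snd \<phi>)"

text \<open>
  HOL-Algebra has no record for semigroups, so \<open>Fisg\<close> is given as a monoid record whose unit is the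
  identity of \<open>G\<close>. The relation \<open>\<cong>\<close> of HOL-Algebra asks only for a bijection of the carriers that
  preserves the product, so it is isomorphism of semigroups.
\<close>

definition Fisg :: "('v, 'e) ugraph \<Rightarrow> ('v, 'e) partial_map monoid" where
  "Fisg G = \<lparr>carrier = fisg_carrier G, mult = pcomp,
     one = (Some |` verts G, Some |` edges G)\<rparr>"

lemma graph_isomorphism_ends:
  assumes "graph_isomorphism G H f g" "graph G" "graph H" "e \<in> edges G"
  shows "ends H (g e) = f ` ends G e"
proof -
  have b: "f ` verts G = verts H" "g e \<in> edges H"
    using assms by (auto simp: graph_isomorphism_def bij_betw_def)
  then have s: "ends H (g e) \<subseteq> f ` verts G" "ends G e \<subseteq> verts G"
    using assms by (auto simp: graph_def)
  have i: "v \<in> ends G e \<longleftrightarrow> f v \<in> ends H (g e)" if "v \<in> verts G" for v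
    using assms that by (auto simp: graph_isomorphism_def)
  show ?thesis using s i by blast
qed

lemma pcomp_closed:
  assumes "\<phi> \<in> fisg_carrier G" "\<psi> \<in> fisg_carrier G"
  shows "pcomp \<psi> \<phi> \<in> fisg_carrier G"
proof -
  obtain H J f g where 1: "\<phi> = ((Some \<circ> f) |` verts H, (Some \<circ> g) |` edges H)"
    "subgraph H G" "subgraph J G" "graph_isomorphism H J f g"
    using assms(1) by (auto simp: fisg_carrier_def)
  obtain K L f' g' where 2: "\<psi> = ((Some \<circ> f') |` verts K, (Some \<circ> g') |` edges K)"
    "subgraph K G" "subgraph L G" "graph_isomorphism K L f' g'"
    using assms(2) by (auto simp: fisg_carrier_def)
  have gr: "graph H" "graph J" "graph K" "graph L" using 1 2 by (auto simp: subgraph_def)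
  have eJ: "ends J (g e) = f ` ends H e" if "e \<in> edges H" for e
    using graph_isomorphism_ends[OF 1(4) gr(1,2) that] .
  have eL: "ends L (g' e) = f' ` ends K e" if "e \<in> edges K" for e
    using graph_isomorphism_ends[OF 2(4) gr(3,4) that] .
  have bij: "inj_on f (verts H)" "f ` verts H = verts J" "inj_on g (edges H)" "g ` edges H = edges J"
    "inj_on f' (verts K)" "f' ` verts K = verts L" "inj_on g' (edges K)" "g' ` edges K = edges L"
    using 1(4) 2(4) by (auto simp: graph_isomorphism_def bij_betw_def)
  define D where "D = \<lparr>verts = {v \<in> verts H. f v \<in> verts K},
    edges = {e \<in> edges H. g e \<in> edges K}, ends = ends G\<rparr>"
  define R where "R = \<lparr>verts = f' ` (verts J \<inter> verts K),
    edges = g' ` (edges J \<inter> edges K), ends = ends G\<rparr>"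
  have HG: "ends H e = ends G e" "ends G e \<subseteq> verts H" "card (ends G e) \<in> {1,2}" if "e \<in> edges H" for e
    using 1(2) that by (auto simp: subgraph_def graph_def dest!: bspec[OF _ that])
  have JG: "ends J e = ends G e" "ends G e \<subseteq> verts J" if "e \<in> edges J" for e
    using 1(3) that by (auto simp: subgraph_def graph_def dest!: bspec[OF _ that])
  have KG: "ends K e = ends G e" "ends G e \<subseteq> verts K" if "e \<in> edges K" for e
    using 2(2) that by (auto simp: subgraph_def graph_def dest!: bspec[OF _ that])
  have LG: "ends L e = ends G e" "ends G e \<subseteq> verts L" "card (ends G e) \<in> {1,2}" if "e \<in> edges L" for e
    using 2(3) that by (auto simp: subgraph_def graph_def dest!: bspec[OF _ that])
  have k: "ends G e \<subseteq> {v \<in> verts H. f v \<in> verts K}" if "e \<in> edges H" "g e \<in> edges K" for e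
  proof -
    have "g e \<in> edges J" using bij(4) that by auto
    then have "f ` ends G e \<subseteq> verts K" using eJ[OF that(1)] HG(1)[OF that(1)] KG(2)[OF that(2)] JG(1) by auto
    then show ?thesis using HG(2)[OF that(1)] by auto
  qed
  have l: "ends G (g' e) = f' ` ends G e" if "e \<in> edges K" for e
    using eL[OF that] KG(1)[OF that] LG(1)[of "g' e"] bij(8) imageI[OF that, of g'] by simp
  have j: "ends G (g e) = f ` ends G e" if "e \<in> edges H" for e
    using eJ[OF that] HG(1)[OF that] JG(1)[of "g e"] bij(4) imageI[OF that, of g] by simp
  have D: "subgraph D G"
    using 1(2) HG(3) k by (auto simp: subgraph_def graph_def D_def)
  have R: "subgraph R G"
  proof -
    have "ends G (g' e) \<subseteq> f' ` (verts J \<inter> verts K)" if "e \<in> edges J" "e \<in> edges K" for e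
      using l[OF that(2)] KG(2)[OF that(2)] JG(2)[OF that(1)] by auto
    moreover have "f' ` (verts J \<inter> verts K) \<subseteq> verts G" "g' ` (edges J \<inter> edges K) \<subseteq> edges L"
      "edges L \<subseteq> edges G"
      using 2(3) bij by (auto simp: subgraph_def)
    moreover have "finite (verts J)" "finite (edges J)" using gr by (auto simp: graph_def)
    moreover have "card (ends G (g' e)) \<in> {1, 2}" if "e \<in> edges K" for e
      using LG(3)[of "g' e"] bij(8) imageI[OF that, of g'] by simp
    ultimately show ?thesis unfolding subgraph_def graph_def R_def by auto
  qed
  have I: "graph_isomorphism D R (f' \<circ> f) (g' \<circ> g)"
  proof -
    have "inj_on (f' \<circ> f) (verts D)" "inj_on (g' \<circ> g) (edges D)"
      using bij by (auto simp: D_def inj_on_def)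
    moreover have "(f' \<circ> f) ` verts D = verts R" "(g' \<circ> g) ` edges D = edges R"
      unfolding D_def R_def bij(2,4)[symmetric] by auto
    moreover have "v \<in> ends D e \<longleftrightarrow> (f' \<circ> f) v \<in> ends R ((g' \<circ> g) e)"
      if ve: "v \<in> verts D" "e \<in> edges D" for v e
    proof -
      have "ends G (g' (g e)) = f' ` f ` ends G e" using l j ve by (auto simp: D_def)
      moreover have "inj_on (f' \<circ> f) (verts D)" by fact
      moreover have "ends G e \<subseteq> verts D" using k ve by (auto simp: D_def)
      ultimately show ?thesis
        using ve inj_on_image_mem_iff[of "f' \<circ> f" "verts D" v "ends G e"]
        by (simp add: image_comp D_def R_def)
    qed
    ultimately show ?thesis by (simp add: graph_isomorphism_def bij_betw_def)
  qed
  have "pcomp \<psi> \<phi> = ((Some \<circ> (f' \<circ> f)) |` verts D, (Some \<circ> (g' \<circ> g)) |` edges D)"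
    by (auto simp: pcomp_def 1(1) 2(1) D_def map_comp_def restrict_map_def fun_eq_iff)
  then show ?thesis using D R I by (auto simp: fisg_carrier_def)
qed

lemma monoid_Fisg:
  assumes "graph G"
  shows "monoid (Fisg G)"
proof (rule monoidI)
  fix x y assume "x \<in> carrier (Fisg G)" "y \<in> carrier (Fisg G)"
  then show "x \<otimes>\<^bsub>Fisg G\<^esub> y \<in> carrier (Fisg G)" by (simp add: Fisg_def pcomp_closed)
next
  have "subgraph G G" "graph_isomorphism G G id id"
    using assms by (auto simp: subgraph_def graph_isomorphism_def)
  then have "((Some \<circ> id) |` verts G, (Some \<circ> id) |` edges G) \<in> fisg_carrier G"
    unfolding fisg_carrier_def by blast
  then show "\<one>\<^bsub>Fisg G\<^esub> \<in> carrier (Fisg G)" by (simp add: Fisg_def)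
next
  fix x y z
  show "x \<otimes>\<^bsub>Fisg G\<^esub> y \<otimes>\<^bsub>Fisg G\<^esub> z = x \<otimes>\<^bsub>Fisg G\<^esub> (y \<otimes>\<^bsub>Fisg G\<^esub> z)"
    by (auto simp: Fisg_def pcomp_def map_comp_def fun_eq_iff split: option.splits)
next
  fix x assume "x \<in> carrier (Fisg G)"
  then obtain H J f g where "x = ((Some \<circ> f) |` verts H, (Some \<circ> g) |` edges H)"
    "subgraph H G" "subgraph J G" "graph_isomorphism H J f g"
    by (auto simp: Fisg_def fisg_carrier_def)
  moreover from this have "f ` verts H \<subseteq> verts G" "g ` edges H \<subseteq> edges G"
    "verts H \<subseteq> verts G" "edges H \<subseteq> edges G"
    by (auto simp: subgraph_def graph_isomorphism_def bij_betw_def)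
  ultimately show "\<one>\<^bsub>Fisg G\<^esub> \<otimes>\<^bsub>Fisg G\<^esub> x = x" "x \<otimes>\<^bsub>Fisg G\<^esub> \<one>\<^bsub>Fisg G\<^esub> = x"
    by (auto simp: Fisg_def pcomp_def map_comp_def restrict_map_def fun_eq_iff)
qed

end

theory Submission
  imports Defs
begin

text \<open>
  The idempotents of \<open>Fisg G\<close> are the identity maps of subgraphs, so with their natural order they
  form the lattice of down-sets of the incidence poset of \<open>G\<close>, whose elements are the vertices and
  edges and in which a vertex lies below the edges it bounds. A poset is determined by its lattice
  of down-sets: the principal down-sets are those having a greatest proper sub-down-set. Since every
  edge has an endpoint, the vertices are exactly the minimal elements of the incidence poset, so an
  isomorphism of incidence posets is a graph isomorphism. Conversely, conjugation by a graph
  isomorphism carries \<open>Fisg G\<close> to \<open>Fisg H\<close>.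
\<close>

section \<open>Down-sets of a poset\<close>

definition downsets :: "'a set \<Rightarrow> 'a rel \<Rightarrow> 'a set set" where
  "downsets A r = {X. X \<subseteq> A \<and> (\<forall>x\<in>X. under r x \<subseteq> X)}"

lemma under_in_downsets:
  assumes "partial_order_on A r"
  shows "under r x \<in> downsets A r"
  using assms
  by (fastforce simp: downsets_def under_def partial_order_on_def preorder_on_def trans_def)

lemma in_under_self:
  assumes "partial_order_on A r" "x \<in> A"
  shows "x \<in> under r x"
  using assms by (simp add: under_def partial_order_on_def preorder_on_def refl_on_def)

lemma under_subset_iff:
  assumes "partial_order_on A r" "x \<in> A"
  shows "under r x \<subseteq> under r y \<longleftrightarrow> (x, y) \<in> r"
proof
  assume "under r x \<subseteq> under r y"
  then show "(x, y) \<in> r" using in_under_self[OF assms] by (auto simp: under_def)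
next
  assume "(x, y) \<in> r"
  moreover have "trans r" using assms(1) by (simp add: partial_order_on_def preorder_on_def)
  ultimately show "under r x \<subseteq> under r y" by (auto simp: under_def dest: transD)
qed

lemma inj_on_under:
  assumes "partial_order_on A r"
  shows "inj_on (under r) A"
proof (rule inj_onI)
  fix x y assume "x \<in> A" "y \<in> A" "under r x = under r y"
  then have "(x, y) \<in> r" "(y, x) \<in> r"
    using under_subset_iff[OF assms] by blast+
  then show "x = y" using assms by (auto simp: partial_order_on_def antisym_def)
qed

text \<open>In a family closed under arbitrary unions, such as the down-sets, this is complete
  join-irreducibility. Only inclusion between members of the family occurs, so order isomorphisms of
  families preserve it.\<close>

definition has_greatest_below :: "'a set set \<Rightarrow> 'a set \<Rightarrow> bool" where
  "has_greatest_below \<D> X \<longleftrightarrow> (\<exists>Y\<in>\<D>. Y \<subset> X \<and> (\<forall>Z\<in>\<D>. Z \<subset> X \<longrightarrow> Z \<subseteq> Y))"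

text \<open>If \<open>Y\<close> is the greatest proper sub-down-set of \<open>X\<close> and
  \<open>x\<close> lies in \<open>X\<close> but not in \<open>Y\<close>, then
  \<open>under r x\<close> is a down-set inside \<open>X\<close> but not inside \<open>Y\<close>,
  hence all of \<open>X\<close>. Conversely, \<open>under r x\<close> without \<open>x\<close> is a
  down-set by antisymmetry, and it contains every proper one because a down-set containing
  \<open>x\<close> contains \<open>under r x\<close>.\<close>

lemma principal_downsets:
  assumes r: "partial_order_on A r"
  shows "{X \<in> downsets A r. has_greatest_below (downsets A r) X} = under r ` A"
proof (intro equalityI subsetI)
  fix X assume "X \<in> {X \<in> downsets A r. has_greatest_below (downsets A r) X}"
  then obtain Y where X: "X \<in> downsets A r" and Y: "Y \<subset> X"
    and max: "\<And>Z. Z \<in> downsets A r \<Longrightarrow> Z \<subset> X \<Longrightarrow> Z \<subseteq> Y"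
    by (auto simp: has_greatest_below_def)
  obtain x where x: "x \<in> X" "x \<notin> Y" using Y by auto
  have "x \<in> A" "under r x \<subseteq> X" using X x by (auto simp: downsets_def)
  moreover have "x \<in> under r x"
    using in_under_self[OF r \<open>x \<in> A\<close>] .
  ultimately have "X = under r x"
    using max[OF under_in_downsets[OF r, of x]] x by blast
  then show "X \<in> under r ` A" using \<open>x \<in> A\<close> by blast
next
  fix X assume "X \<in> under r ` A"
  then obtain x where x: "x \<in> A" "X = under r x" by auto
  have xX: "x \<in> under r x"
    using in_under_self[OF r x(1)] x(2) by simp
  have "under r x - {x} \<in> downsets A r"
    using r under_in_downsets[OF r, of x]
    by (fastforce simp: downsets_def under_def partial_order_on_def antisym_def)
  moreover have "Z \<subseteq> under r x - {x}" if "Z \<in> downsets A r" "Z \<subset> under r x" for Z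
    using that by (auto simp: downsets_def)
  ultimately have "has_greatest_below (downsets A r) X"
    using xX x by (auto simp: has_greatest_below_def intro!: bexI[of _ "under r x - {x}"])
  then show "X \<in> {X \<in> downsets A r. has_greatest_below (downsets A r) X}"
    using under_in_downsets[OF r] x by simp
qed

text \<open>Both quantifiers pull back along \<open>\<Phi>\<close>, which is onto
  \<open>\<E>\<close> and preserves and reflects inclusion, hence also strict inclusion.\<close>

lemma has_greatest_below_cong:
  assumes bij: "bij_betw \<Phi> \<D> \<E>"
    and mono: "\<And>X Y. X \<in> \<D> \<Longrightarrow> Y \<in> \<D> \<Longrightarrow> \<Phi> X \<subseteq> \<Phi> Y \<longleftrightarrow> X \<subseteq> Y"
    and X: "X \<in> \<D>"
  shows "has_greatest_below \<E> (\<Phi> X) \<longleftrightarrow> has_greatest_below \<D> X"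
proof -
  have \<E>: "\<E> = \<Phi> ` \<D>" using bij by (simp add: bij_betw_def)
  have strict: "\<Phi> Y \<subset> \<Phi> X \<longleftrightarrow> Y \<subset> X" if "Y \<in> \<D>" for Y
    using mono X that by (auto simp: less_le_not_le)
  show ?thesis
    using mono strict by (auto simp: has_greatest_below_def \<E>)
qed

text \<open>Being principal is visible in the order of the down-sets, so \<open>\<Phi>\<close>
  matches the principal down-sets of the two posets. Each poset is order-embedded by
  \<open>under\<close> as its principal down-sets, which turns this matching into one of
  points.\<close>

lemma poset_iso_if_downsets_iso:
  assumes r: "partial_order_on A r" and s: "partial_order_on B s"
    and bij: "bij_betw \<Phi> (downsets A r) (downsets B s)"
    and mono: "\<And>X Y. X \<in> downsets A r \<Longrightarrow> Y \<in> downsets A r \<Longrightarrow> \<Phi> X \<subseteq> \<Phi> Y \<longleftrightarrow> X \<subseteq> Y"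
  obtains h where "bij_betw h A B"
    "\<And>x y. x \<in> A \<Longrightarrow> y \<in> A \<Longrightarrow> (h x, h y) \<in> s \<longleftrightarrow> (x, y) \<in> r"
proof
  let ?D = "downsets A r" and ?E = "downsets B s"
  \<comment> \<open>\<open>h x\<close> is the generator of the down-set
    \<open>\<Phi> (under r x)\<close>.\<close>
  define h where "h = inv_into B (under s) \<circ> \<Phi> \<circ> under r"
  have "\<Phi> ` {X \<in> ?D. has_greatest_below ?D X} = {Y \<in> ?E. has_greatest_below ?E Y}"
  proof (intro equalityI subsetI)
    fix Y assume Y: "Y \<in> {Y \<in> ?E. has_greatest_below ?E Y}"
    then obtain X where "X \<in> ?D" "Y = \<Phi> X" using bij by (auto simp: bij_betw_def)
    then show "Y \<in> \<Phi> ` {X \<in> ?D. has_greatest_below ?D X}"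
      using Y has_greatest_below_cong[OF bij mono] by simp
  qed (use has_greatest_below_cong[OF bij mono] bij in \<open>auto simp: bij_betw_def\<close>)
  then have img: "\<Phi> ` under r ` A = under s ` B"
    using principal_downsets[OF r] principal_downsets[OF s] by simp
  have "inj_on \<Phi> (under r ` A)"
    using bij under_in_downsets[OF r] by (auto simp: bij_betw_def intro: inj_on_subset)
  then have "bij_betw \<Phi> (under r ` A) (under s ` B)"
    using img by (simp add: bij_betw_def)
  moreover have "bij_betw (under r) A (under r ` A)" "bij_betw (under s) B (under s ` B)"
    using inj_on_under[OF r] inj_on_under[OF s] by (auto simp: bij_betw_def)
  ultimately show h: "bij_betw h A B"
    unfolding h_def by (metis bij_betw_inv_into bij_betw_trans comp_assoc)
  \<comment> \<open>By \<open>img\<close> the set \<open>\<Phi> (under r x)\<close> is principal, so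
    \<open>inv_into\<close> returns an actual generator and not an arbitrary value.\<close>
  have under_h: "under s (h x) = \<Phi> (under r x)" if "x \<in> A" for x
    using that img by (auto simp: h_def intro!: f_inv_into_f)
  fix x y assume "x \<in> A" "y \<in> A"
  moreover have "h x \<in> B" using h \<open>x \<in> A\<close> by (auto simp: bij_betw_def)
  ultimately show "(h x, h y) \<in> s \<longleftrightarrow> (x, y) \<in> r"
    using under_subset_iff[OF r] under_subset_iff[OF s] under_h mono under_in_downsets[OF r]
    by metis
qed

section \<open>Elements and idempotents of \<open>Fisg\<close>\<close>

text \<open>The subgraphs hidden in \<open>fisg_carrier\<close> are determined by the partial maps:
  their vertex and edge sets are the domains and ranges of \<open>m\<close> and \<open>n\<close>,
  and their endpoints come from \<open>G\<close>. Membership thus becomes a condition on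
  \<open>m\<close> and \<open>n\<close> alone.\<close>

lemma fisg_carrier_iff:
  assumes G: "graph G"
  shows "(m, n) \<in> fisg_carrier G \<longleftrightarrow>
    dom m \<subseteq> verts G \<and> ran m \<subseteq> verts G \<and> inj_on m (dom m) \<and>
    dom n \<subseteq> edges G \<and> ran n \<subseteq> edges G \<and> inj_on n (dom n) \<and>
    (\<forall>e e'. n e = Some e' \<longrightarrow> ends G e \<subseteq> dom m \<and> Some ` ends G e' = m ` ends G e)"
  (is "?L \<longleftrightarrow> ?R")
proof
  assume ?L
  then obtain K J a b where mn: "m = (Some \<circ> a) |` verts K" "n = (Some \<circ> b) |` edges K"
    and K: "subgraph K G" and J: "subgraph J G" and I: "graph_isomorphism K J a b"
    by (auto simp: fisg_carrier_def)
  have bij: "inj_on a (verts K)" "a ` verts K = verts J" "inj_on b (edges K)" "b ` edges K = edges J"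
    using I by (auto simp: graph_isomorphism_def bij_betw_def)
  have sub: "verts K \<subseteq> verts G" "verts J \<subseteq> verts G" "edges K \<subseteq> edges G" "edges J \<subseteq> edges G"
    using K J by (auto simp: subgraph_def)
  have "ends G e \<subseteq> verts K" "ends G (b e) = a ` ends G e" if e: "e \<in> edges K" for e
  proof -
    show "ends G e \<subseteq> verts K" using K e by (metis graph_def subgraph_def)
    have "b e \<in> edges J" using bij e by auto
    moreover have "ends J (b e) = a ` ends K e"
      using graph_isomorphism_ends[OF I _ _ e] K J by (auto simp: subgraph_def)
    ultimately show "ends G (b e) = a ` ends G e" using K J e by (auto simp: subgraph_def)
  qed
  note ends = this
  have "ends G e \<subseteq> verts K \<and> Some ` ends G e' = m ` ends G e" if "n e = Some e'" for e e'
  proof -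
    have e: "e \<in> edges K" "e' = b e"
      using that by (auto simp: mn restrict_map_def split: if_splits)
    have "Some ` ends G e' = m ` ends G e"
      unfolding e(2) ends(2)[OF e(1)] image_image
      by (intro image_cong) (use ends(1)[OF e(1)] in \<open>auto simp: mn\<close>)
    then show ?thesis using ends(1)[OF e(1)] by simp
  qed
  moreover have "dom m = verts K" "dom n = edges K" by (auto simp: mn)
  moreover have "ran m = a ` verts K" "ran n = b ` edges K"
    by (auto simp: mn ran_def restrict_map_def)
  moreover have "inj_on m (verts K)" "inj_on n (edges K)"
    using bij by (auto simp: mn inj_on_def)
  ultimately show ?R
    using sub by (simp add: bij)
next
  assume ?R
  then have m: "dom m \<subseteq> verts G" "ran m \<subseteq> verts G" "inj_on m (dom m)"
    and n: "dom n \<subseteq> edges G" "ran n \<subseteq> edges G" "inj_on n (dom n)"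
    and ends: "\<And>e e'. n e = Some e' \<Longrightarrow> ends G e \<subseteq> dom m"
      "\<And>e e'. n e = Some e' \<Longrightarrow> Some ` ends G e' = m ` ends G e"
    by simp_all
  let ?K = "\<lparr>verts = dom m, edges = dom n, ends = ends G\<rparr>"
  let ?J = "\<lparr>verts = ran m, edges = ran n, ends = ends G\<rparr>"
  have "finite (verts G)" "finite (edges G)" using G by (auto simp: graph_def)
  then have fin: "finite (dom m)" "finite (ran m)" "finite (dom n)" "finite (ran n)"
    using m(1,2) n(1,2) finite_subset by metis+
  have card: "card (ends G e) \<in> {1, 2}" if "e \<in> edges G" for e
    using G that by (auto simp: graph_def)
  have "subgraph ?K G"
  proof -
    have "\<forall>e\<in>dom n. ends G e \<subseteq> dom m \<and> card (ends G e) \<in> {1, 2}"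
      using n(1) ends(1) card unfolding dom_def by blast
    then show ?thesis using m(1) n(1) fin by (simp add: subgraph_def graph_def)
  qed
  moreover have "subgraph ?J G"
  proof -
    \<comment> \<open>That the range is closed under endpoints is not a clause of the criterion; it
      follows because endpoints of \<open>e'\<close> are values of \<open>m\<close>.\<close>
    have "ends G e' \<subseteq> ran m" if "n e = Some e'" for e e'
    proof
      fix v assume "v \<in> ends G e'"
      then have "Some v \<in> m ` ends G e" using ends(2)[OF that] by auto
      then show "v \<in> ran m" by (auto simp: ran_def)
    qed
    then have "\<forall>e\<in>ran n. ends G e \<subseteq> ran m \<and> card (ends G e) \<in> {1, 2}"
      using n(2) card unfolding ran_def by blast
    then show ?thesis using m(2) n(2) fin by (simp add: subgraph_def graph_def)
  qed
  moreover have "graph_isomorphism ?K ?J (the \<circ> m) (the \<circ> n)"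
    unfolding graph_isomorphism_def
  proof (intro conjI ballI)
    have the_bij: "bij_betw (the \<circ> p) (dom p) (ran p)" if "inj_on p (dom p)" for p :: "'x \<rightharpoonup> 'x"
      using that by (auto simp: bij_betw_def inj_on_def dom_def ran_def image_def)
    show "bij_betw (the \<circ> m) (verts ?K) (verts ?J)" "bij_betw (the \<circ> n) (edges ?K) (edges ?J)"
      using the_bij m(3) n(3) by auto
    fix v e assume "v \<in> verts ?K" "e \<in> edges ?K"
    then obtain w e' where w: "m v = Some w" "n e = Some e'" by auto
    have "w \<in> ends G e' \<longleftrightarrow> m v \<in> m ` ends G e"
      using ends(2)[OF w(2)] w(1) by (metis image_iff option.inject)
    also have "\<dots> \<longleftrightarrow> v \<in> ends G e"
      using m(3) w ends(1)[OF w(2)] by (intro inj_on_image_mem_iff[of m "dom m"]) auto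
    finally show "v \<in> ends ?K e \<longleftrightarrow> (the \<circ> m) v \<in> ends ?J ((the \<circ> n) e)"
      using w by simp
  qed
  moreover have "(Some \<circ> (the \<circ> m)) |` dom m = m" "(Some \<circ> (the \<circ> n)) |` dom n = n"
    by (auto simp: restrict_map_def fun_eq_iff domIff)
  ultimately show ?L
    unfolding fisg_carrier_def
    by (intro CollectI exI[of _ ?K] exI[of _ ?J] exI[of _ "the \<circ> m"] exI[of _ "the \<circ> n"]) simp
qed

section \<open>The incidence poset of a graph\<close>

definition incidence :: "('v, 'e) ugraph \<Rightarrow> ('v + 'e) rel" where
  "incidence G = Id_on (verts G <+> edges G) \<union> {(Inl v, Inr e) | v e. e \<in> edges G \<and> v \<in> ends G e}"

text \<open>Strict relations lead only from a vertex to an edge, so they never compose and never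
  reverse. Endpoints being vertices keeps the relation inside the disjoint sum.\<close>

lemma partial_order_incidence:
  assumes "graph G"
  shows "partial_order_on (verts G <+> edges G) (incidence G)"
  using assms
  by (auto simp: partial_order_on_def preorder_on_def refl_on_def trans_def antisym_def
      incidence_def graph_def)

text \<open>The only strict predecessors are endpoints of edges, so for a graph \<open>G\<close> the
  down-sets are the joint vertex and edge sets of subgraphs.\<close>

lemma downsets_incidence_iff:
  "X \<in> downsets (verts G <+> edges G) (incidence G) \<longleftrightarrow>
    X \<subseteq> verts G <+> edges G \<and> (\<forall>e v. Inr e \<in> X \<longrightarrow> v \<in> ends G e \<longrightarrow> Inl v \<in> X)"
  (is "?L \<longleftrightarrow> ?R")
proof
  assume X: ?L
  have "Inl v \<in> X" if "Inr e \<in> X" "v \<in> ends G e" for e v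
  proof -
    have "e \<in> edges G" using X that(1) by (auto simp: downsets_def)
    then have "Inl v \<in> under (incidence G) (Inr e)"
      using that(2) by (simp add: under_def incidence_def)
    then show ?thesis using X that(1) by (auto simp: downsets_def)
  qed
  then show ?R using X by (auto simp: downsets_def)
qed (auto simp: downsets_def under_def incidence_def)

section \<open>Idempotents as identity maps of subgraphs\<close>

definition idempotents :: "'a monoid \<Rightarrow> 'a set" where
  "idempotents S = {x \<in> carrier S. x \<otimes>\<^bsub>S\<^esub> x = x}"

text \<open>Defined for arbitrary sets, not only for down-sets, so that products become
  intersections without side conditions; being a subgraph is left to membership in the
  carrier.\<close>

definition ident_on :: "('v + 'e) set \<Rightarrow> ('v, 'e) partial_map" where
  "ident_on X = (Some |` (Inl -` X), Some |` (Inr -` X))"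

lemma restrict_Some_comp: "(Some |` A) \<circ>\<^sub>m (Some |` B) = Some |` (A \<inter> B)"
  by (auto simp: map_comp_def restrict_map_def fun_eq_iff)

lemma restrict_Some_eq_iff: "Some |` A = Some |` B \<longleftrightarrow> A = B"
  by (auto simp: restrict_map_def fun_eq_iff split: if_splits)

lemma ident_on_eq_iff: "ident_on X = ident_on Y \<longleftrightarrow> X = Y"
proof -
  have "X = Y" if "Inl -` X = Inl -` Y" "Inr -` X = Inr -` Y"
  proof (rule Set.set_eqI)
    show "x \<in> X \<longleftrightarrow> x \<in> Y" for x using that by (cases x) auto
  qed
  then show ?thesis by (auto simp: ident_on_def restrict_Some_eq_iff)
qed

lemma pcomp_ident_on: "pcomp (ident_on X) (ident_on Y) = ident_on (X \<inter> Y)"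
  by (simp add: pcomp_def ident_on_def restrict_Some_comp)

text \<open>If \<open>m x = Some y\<close>, then idempotency makes \<open>m y\<close> equal to
  \<open>m x\<close>, and injectivity gives \<open>y = x\<close>.\<close>

lemma idempotent_partial_map:
  assumes "m \<circ>\<^sub>m m = m" "inj_on m (dom m)"
  shows "Some |` dom m = m"
proof
  fix x
  show "(Some |` dom m) x = m x"
  proof (cases "m x")
    case (Some y)
    then have "m y = m x" using fun_cong[OF assms(1), of x] by simp
    then have "y = x" using inj_onD[OF assms(2), of y x] Some by auto
    then show ?thesis using Some by (auto simp: restrict_map_def)
  qed (auto simp: restrict_map_def)
qed

text \<open>For an identity map the clauses of \<open>fisg_carrier_iff\<close> on injectivity and on
  images of endpoints hold trivially. What remains is containment in \<open>G\<close> and closure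
  under endpoints.\<close>

lemma ident_on_in_carrier_iff:
  assumes G: "graph G"
  shows "ident_on X \<in> fisg_carrier G \<longleftrightarrow> X \<in> downsets (verts G <+> edges G) (incidence G)"
proof -
  have dr: "dom (Some |` A) = A" "ran (Some |` A) = A" "inj_on (Some |` A) A" for A :: "'x set"
    by (auto simp: ran_def restrict_map_def inj_on_def split: if_splits)
  have im: "(Some |` A) ` B = Some ` B" if "B \<subseteq> A" for A B :: "'x set"
    using that by (intro image_cong) auto
  have "X \<subseteq> verts G <+> edges G \<longleftrightarrow> Inl -` X \<subseteq> verts G \<and> Inr -` X \<subseteq> edges G"
    by (auto intro: sum.exhaust) (metis InlI InrI subsetD sum.exhaust vimageI)
  moreover have "(\<forall>e e'. (Some |` (Inr -` X)) e = Some e' \<longrightarrow> ends G e \<subseteq> Inl -` X \<and>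
      Some ` ends G e' = (Some |` (Inl -` X)) ` ends G e) \<longleftrightarrow>
    (\<forall>e v. Inr e \<in> X \<longrightarrow> v \<in> ends G e \<longrightarrow> Inl v \<in> X)"
    using im by (auto simp: restrict_map_def subset_iff split: if_splits)
  ultimately show ?thesis
    unfolding ident_on_def fisg_carrier_iff[OF G] downsets_incidence_iff by (auto simp: dr)
qed

lemma bij_betw_ident_on:
  assumes G: "graph G"
  shows "bij_betw ident_on (downsets (verts G <+> edges G) (incidence G)) (idempotents (Fisg G))"
proof (rule bij_betw_imageI)
  show "inj_on ident_on (downsets (verts G <+> edges G) (incidence G))"
    by (simp add: inj_on_def ident_on_eq_iff)
  show "ident_on ` downsets (verts G <+> edges G) (incidence G) = idempotents (Fisg G)"
  proof (intro equalityI subsetI)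
    fix \<phi> assume "\<phi> \<in> idempotents (Fisg G)"
    then obtain m n where \<phi>: "\<phi> = (m, n)" "(m, n) \<in> fisg_carrier G" "m \<circ>\<^sub>m m = m" "n \<circ>\<^sub>m n = n"
      by (cases \<phi>) (auto simp: idempotents_def Fisg_def pcomp_def)
    have "inj_on m (dom m)" "inj_on n (dom n)"
      using fisg_carrier_iff[OF G, of m n] \<phi>(2) by simp_all
    then have "Some |` dom m = m" "Some |` dom n = n"
      using idempotent_partial_map \<phi>(3,4) by blast+
    \<comment> \<open>An idempotent is recovered from its domain \<open>dom m <+> dom n\<close>,
      which is a down-set because its identity map is the given element of the carrier.\<close>
    moreover have "Inl -` (dom m <+> dom n) = dom m" "Inr -` (dom m <+> dom n) = dom n" by auto
    ultimately have "ident_on (dom m <+> dom n) = \<phi>" by (simp add: ident_on_def \<phi>(1))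
    then show "\<phi> \<in> ident_on ` downsets (verts G <+> edges G) (incidence G)"
      using \<phi>(1,2) ident_on_in_carrier_iff[OF G] by (metis imageI)
  qed (auto simp: idempotents_def Fisg_def pcomp_ident_on ident_on_in_carrier_iff[OF G])
qed

text \<open>The equation defining an idempotent is preserved by a homomorphism and reflected by
  injectivity, which applies because the square stays in the carrier.\<close>

lemma iso_bij_betw_idempotents:
  assumes "\<Theta> \<in> iso S T" "monoid S"
  shows "bij_betw \<Theta> (idempotents S) (idempotents T)"
proof -
  have inj: "inj_on \<Theta> (carrier S)" and img: "\<Theta> ` carrier S = carrier T"
    and hom: "\<And>x y. x \<in> carrier S \<Longrightarrow> y \<in> carrier S \<Longrightarrow> \<Theta> (x \<otimes>\<^bsub>S\<^esub> y) = \<Theta> x \<otimes>\<^bsub>T\<^esub> \<Theta> y"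
    using assms(1) by (auto simp: iso_def bij_betw_def hom_def)
  have "\<Theta> x \<in> idempotents T \<longleftrightarrow> x \<in> idempotents S" if "x \<in> carrier S" for x
    using that hom[of x x, symmetric] inj_onD[OF inj, of "x \<otimes>\<^bsub>S\<^esub> x" x] img
      monoid.m_closed[OF assms(2)]
    by (auto simp: idempotents_def)
  then have "\<Theta> ` idempotents S = idempotents T"
    using img by (fastforce simp: idempotents_def)
  then show ?thesis
    using inj by (auto simp: bij_betw_def idempotents_def intro: inj_on_subset)
qed

section \<open>Recovering the graph\<close>

lemma graph_isomorphic_if_incidence_iso:
  assumes G: "graph G" and H: "graph H"
    and h: "bij_betw h (verts G <+> edges G) (verts H <+> edges H)"
    and mono: "\<And>x y. x \<in> verts G <+> edges G \<Longrightarrow> y \<in> verts G <+> edges G \<Longrightarrow>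
      (h x, h y) \<in> incidence H \<longleftrightarrow> (x, y) \<in> incidence G"
  shows "graph_isomorphic G H"
proof -
  \<comment> \<open>Edges are the non-minimal elements, since every edge, loop or not, has an
    endpoint strictly below it. This order-theoretic description lets \<open>h\<close> send edges to
    edges and vertices to vertices.\<close>
  have edge_iff: "x \<in> Inr ` edges K \<longleftrightarrow> (\<exists>y\<in>verts K <+> edges K. y \<noteq> x \<and> (y, x) \<in> incidence K)"
    if K: "graph K" and x: "x \<in> verts K <+> edges K" for K :: "('x, 'y) ugraph" and x
  proof
    assume "x \<in> Inr ` edges K"
    then obtain e where e: "x = Inr e" "e \<in> edges K" by auto
    have "ends K e \<subseteq> verts K" "ends K e \<noteq> {}" using K e by (auto simp: graph_def)
    then show "\<exists>y\<in>verts K <+> edges K. y \<noteq> x \<and> (y, x) \<in> incidence K"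
      using e by (fastforce simp: incidence_def)
  qed (auto simp: incidence_def)
  have img: "h ` (verts G <+> edges G) = verts H <+> edges H" and inj: "inj_on h (verts G <+> edges G)"
    using h by (auto simp: bij_betw_def)
  have h_edge: "h x \<in> Inr ` edges H \<longleftrightarrow> x \<in> Inr ` edges G" if x: "x \<in> verts G <+> edges G" for x
  proof -
    have "h x \<in> Inr ` edges H \<longleftrightarrow> (\<exists>y\<in>verts G <+> edges G. h y \<noteq> h x \<and> (h y, h x) \<in> incidence H)"
      using edge_iff[OF H, of "h x"] x img by (metis (no_types, lifting) image_iff)
    also have "\<dots> \<longleftrightarrow> x \<in> Inr ` edges G"
      using edge_iff[OF G x] mono x inj by (metis inj_onD)
    finally show ?thesis .
  qed
  \<comment> \<open>\<open>projl\<close> and \<open>projr\<close> are meaningful only on their own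
    summand; \<open>h_edge\<close> guarantees that \<open>h\<close> preserves the summands, which
    gives \<open>hf\<close> and \<open>hg\<close>.\<close>
  define f where "f = projl \<circ> h \<circ> Inl"
  define g where "g = projr \<circ> h \<circ> Inr"
  have hf: "h (Inl v) = Inl (f v)" "f v \<in> verts H" if "v \<in> verts G" for v
  proof -
    have "h (Inl v) \<in> verts H <+> edges H" "h (Inl v) \<notin> Inr ` edges H"
      using img h_edge[of "Inl v"] that by auto
    then show "h (Inl v) = Inl (f v)" "f v \<in> verts H" by (auto simp: f_def)
  qed
  have hg: "h (Inr e) = Inr (g e)" "g e \<in> edges H" if "e \<in> edges G" for e
  proof -
    have "h (Inr e) \<in> Inr ` edges H" using h_edge[of "Inr e"] that by auto
    then show "h (Inr e) = Inr (g e)" "g e \<in> edges H" by (auto simp: g_def)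
  qed
  have "inj_on f (verts G)"
    using hf(1) inj by (metis InlI inj_on_def sum.inject(1))
  moreover have "inj_on g (edges G)"
    using hg(1) inj by (metis InrI inj_on_def sum.inject(2))
  moreover have "f ` verts G = verts H"
  proof (intro equalityI subsetI)
    fix w assume "w \<in> verts H"
    then obtain x where x: "x \<in> verts G <+> edges G" "h x = Inl w" using img by (metis InlI imageE)
    then obtain v where "x = Inl v" "v \<in> verts G" using hg(1) by (metis Inl_Inr_False PlusE)
    then show "w \<in> f ` verts G" using x(2) hf(1)[of v] by auto
  qed (use hf(2) in blast)
  moreover have "g ` edges G = edges H"
  proof (intro equalityI subsetI)
    fix d assume "d \<in> edges H"
    then obtain x where x: "x \<in> verts G <+> edges G" "h x = Inr d" using img by (metis InrI imageE)
    then obtain e where "x = Inr e" "e \<in> edges G" using hf(1) by (metis Inl_Inr_False PlusE)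
    then show "d \<in> g ` edges G" using x(2) hg(1)[of e] by auto
  qed (use hg(2) in blast)
  moreover have "v \<in> ends G e \<longleftrightarrow> f v \<in> ends H (g e)" if "v \<in> verts G" "e \<in> edges G" for v e
    using mono[of "Inl v" "Inr e"] that hf[OF that(1)] hg[OF that(2)] by (auto simp: incidence_def)
  ultimately have "graph_isomorphism G H f g"
    by (simp add: graph_isomorphism_def bij_betw_def)
  then show ?thesis by (auto simp: graph_isomorphic_def)
qed

lemma graph_isomorphic_if_Fisg_iso:
  assumes G: "graph G" and H: "graph H" and iso: "Fisg G \<cong> Fisg H"
  shows "graph_isomorphic G H"
proof -
  obtain \<Theta> where \<Theta>: "\<Theta> \<in> iso (Fisg G) (Fisg H)" using iso by (auto simp: is_iso_def)
  let ?A = "verts G <+> edges G" and ?B = "verts H <+> edges H"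
  let ?D = "downsets ?A (incidence G)" and ?E = "downsets ?B (incidence H)"
  \<comment> \<open>This is \<open>\<Theta>\<close> on idempotents, read as a map between
    down-sets.\<close>
  define \<Phi> where "\<Phi> = inv_into ?E ident_on \<circ> \<Theta> \<circ> ident_on"
  have bij\<Theta>: "bij_betw \<Theta> (idempotents (Fisg G)) (idempotents (Fisg H))"
    using iso_bij_betw_idempotents[OF \<Theta> monoid_Fisg[OF G]] .
  note bijG = bij_betw_ident_on[OF G] and bijH = bij_betw_ident_on[OF H]
  have bij: "bij_betw \<Phi> ?D ?E"
    unfolding \<Phi>_def using bij\<Theta> bijG bijH by (metis bij_betw_inv_into bij_betw_trans comp_assoc)
  have ident_\<Phi>: "ident_on (\<Phi> X) = \<Theta> (ident_on X)" if "X \<in> ?D" for X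
    using that bij\<Theta> bijG bijH unfolding \<Phi>_def
    by (metis bij_betw_apply bij_betw_inv_into_right comp_apply)
  \<comment> \<open>Inclusion is recovered from the product: products of identity maps are
    intersections, and \<open>X \<subseteq> Y\<close> means \<open>X \<inter> Y = X\<close>, which
    the injective map \<open>\<Phi>\<close> preserves and reflects.\<close>
  have mono: "\<Phi> X \<subseteq> \<Phi> Y \<longleftrightarrow> X \<subseteq> Y" if "X \<in> ?D" "Y \<in> ?D" for X Y
  proof -
    have car: "ident_on X \<in> carrier (Fisg G)" "ident_on Y \<in> carrier (Fisg G)"
      using that ident_on_in_carrier_iff[OF G] by (auto simp: Fisg_def)
    have "ident_on (\<Phi> X \<inter> \<Phi> Y) = \<Theta> (ident_on X) \<otimes>\<^bsub>Fisg H\<^esub> \<Theta> (ident_on Y)"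
      using that by (simp add: Fisg_def ident_\<Phi> flip: pcomp_ident_on)
    also have "\<dots> = \<Theta> (ident_on X \<otimes>\<^bsub>Fisg G\<^esub> ident_on Y)"
      using \<Theta> car by (simp add: iso_def hom_def)
    also have "\<dots> = \<Theta> (ident_on (X \<inter> Y))" by (simp add: Fisg_def pcomp_ident_on)
    also have "\<dots> = ident_on (\<Phi> (X \<inter> Y))"
      using that by (intro ident_\<Phi>[symmetric]) (auto simp: downsets_def)
    finally have "\<Phi> X \<inter> \<Phi> Y = \<Phi> (X \<inter> Y)" by (simp add: ident_on_eq_iff)
    moreover have "X \<inter> Y \<in> ?D" using that by (auto simp: downsets_def)
    ultimately have "\<Phi> X \<inter> \<Phi> Y = \<Phi> X \<longleftrightarrow> X \<inter> Y = X"
      using that bij by (auto simp: bij_betw_def inj_on_eq_iff)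
    then show ?thesis by blast
  qed
  obtain h where "bij_betw h ?A ?B"
    "\<And>x y. x \<in> ?A \<Longrightarrow> y \<in> ?A \<Longrightarrow> (h x, h y) \<in> incidence H \<longleftrightarrow> (x, y) \<in> incidence G"
    using poset_iso_if_downsets_iso[OF partial_order_incidence[OF G] partial_order_incidence[OF H]
        bij mono] by blast
  then show ?thesis using graph_isomorphic_if_incidence_iso[OF G H] by blast
qed

section \<open>Transport along a graph isomorphism\<close>

lemma graph_isomorphism_inv_into:
  assumes I: "graph_isomorphism G H f g"
  shows "graph_isomorphism H G (inv_into (verts G) f) (inv_into (edges G) g)"
proof -
  have b: "bij_betw f (verts G) (verts H)" "bij_betw g (edges G) (edges H)"
    using I by (auto simp: graph_isomorphism_def)
  have "v \<in> ends H e \<longleftrightarrow> inv_into (verts G) f v \<in> ends G (inv_into (edges G) g e)"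
    if "v \<in> verts H" "e \<in> edges H" for v e
  proof -
    obtain x y where "x \<in> verts G" "y \<in> edges G" "v = f x" "e = g y"
      using b \<open>v \<in> verts H\<close> \<open>e \<in> edges H\<close> unfolding bij_betw_def by blast
    then show ?thesis
      using I b by (simp add: graph_isomorphism_def bij_betw_inv_into_left)
  qed
  then show ?thesis using b by (simp add: graph_isomorphism_def bij_betw_inv_into)
qed

text \<open>The conjugate of \<open>m\<close> by \<open>f\<close>. The explicit \<open>None\<close>
  outside the image of \<open>A\<close> is there because \<open>inv_into\<close> is arbitrary at
  such points.\<close>

definition conj_map :: "('a \<Rightarrow> 'b) \<Rightarrow> 'a set \<Rightarrow> ('a \<rightharpoonup> 'a) \<Rightarrow> ('b \<rightharpoonup> 'b)" where
  "conj_map f A m = (\<lambda>y. if y \<in> f ` A then map_option f (m (inv_into A f y)) else None)"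

lemma conj_map_apply:
  assumes "inj_on f A" "x \<in> A"
  shows "conj_map f A m (f x) = map_option f (m x)"
  using assms by (simp add: conj_map_def)

text \<open>The graph of the conjugate is the graph of \<open>m\<close> with \<open>f\<close>
  applied to both coordinates. Each witness \<open>x\<close> lies in \<open>A\<close>, where
  \<open>inv_into\<close> undoes \<open>f\<close>.\<close>

lemma conj_map_eq_Some_iff:
  assumes "inj_on f A" "dom m \<subseteq> A"
  shows "conj_map f A m y = Some z \<longleftrightarrow> (\<exists>x x'. y = f x \<and> z = f x' \<and> m x = Some x')"
  using assms by (force simp: conj_map_def)

lemma dom_conj_map:
  assumes "inj_on f A" "dom m \<subseteq> A"
  shows "dom (conj_map f A m) = f ` dom m"
  using conj_map_eq_Some_iff[OF assms] by (auto simp: dom_def)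

lemma ran_conj_map:
  assumes "inj_on f A" "dom m \<subseteq> A"
  shows "ran (conj_map f A m) = f ` ran m"
  using conj_map_eq_Some_iff[OF assms] by (auto simp: ran_def)

lemma inj_on_conj_map:
  assumes "inj_on f A" "dom m \<subseteq> A" "ran m \<subseteq> A" "inj_on m (dom m)"
  shows "inj_on (conj_map f A m) (dom (conj_map f A m))"
proof (rule inj_onI)
  fix y y' assume "y \<in> dom (conj_map f A m)" "conj_map f A m y = conj_map f A m y'"
  then obtain z where "conj_map f A m y = Some z" "conj_map f A m y' = Some z"
    by (metis domD)
  then obtain x x' w w' where x: "y = f x" "z = f w" "m x = Some w" "y' = f x'" "z = f w'" "m x' = Some w'"
    using conj_map_eq_Some_iff[OF assms(1,2)] by metis
  then have "w \<in> A" "w' \<in> A" using assms(3) by (auto simp: ran_def)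
  then have "w = w'" using x assms(1) by (auto simp: inj_on_def)
  then have "x = x'" using x inj_onD[OF assms(4), of x x'] by auto
  then show "y = y'" using x by simp
qed

text \<open>The intermediate point lies in \<open>A\<close> by the assumption on
  \<open>ran m\<close>, so the \<open>f\<close> ending the first conjugate cancels the inverse
  opening the second.\<close>

lemma conj_map_comp:
  assumes "inj_on f A" "ran m \<subseteq> A"
  shows "conj_map f A (p \<circ>\<^sub>m m) = conj_map f A p \<circ>\<^sub>m conj_map f A m"
proof
  fix y
  show "conj_map f A (p \<circ>\<^sub>m m) y = (conj_map f A p \<circ>\<^sub>m conj_map f A m) y"
  proof (cases "m (inv_into A f y)")
    case (Some x)
    then have "x \<in> A" using assms(2) by (auto simp: ran_def)
    then show ?thesis using assms Some by (simp add: conj_map_def)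
  qed (simp add: conj_map_def map_comp_def)
qed

text \<open>On \<open>A\<close> the inverse cancels \<open>f\<close> both at the argument and, since
  \<open>ran m\<close> lies in \<open>A\<close>, at the value. Off \<open>A\<close> both sides are
  \<open>None\<close>.\<close>

lemma conj_map_inverse:
  assumes f: "bij_betw f A B" and m: "dom m \<subseteq> A" "ran m \<subseteq> A"
  shows "conj_map (inv_into A f) B (conj_map f A m) = m"
proof
  fix x
  have inj: "inj_on f A" and B: "B = f ` A" using f by (auto simp: bij_betw_def)
  have inv: "inj_on (inv_into A f) B" using f by (metis bij_betw_def bij_betw_inv_into)
  show "conj_map (inv_into A f) B (conj_map f A m) x = m x"
  proof (cases "x \<in> A")
    case True
    then have "conj_map (inv_into A f) B (conj_map f A m) (inv_into A f (f x))
        = map_option (inv_into A f) (map_option f (m x))"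
      using conj_map_apply[OF inv, of "f x"] conj_map_apply[OF inj True] B by simp
    also have "\<dots> = m x"
    proof (cases "m x")
      case (Some y)
      then have "y \<in> A" using m by (auto simp: ran_def)
      then show ?thesis using Some inj by simp
    qed simp
    finally show ?thesis using True inj by simp
  next
    case False
    then have "x \<notin> inv_into A f ` B" using B by (auto simp: inv_into_into)
    moreover have "m x = None" using False m by auto
    ultimately show ?thesis by (simp add: conj_map_def)
  qed
qed

section \<open>Conjugation as an isomorphism of semigroups\<close>

definition transport ::
  "('v, 'e) ugraph \<Rightarrow> ('v \<Rightarrow> 'w) \<Rightarrow> ('e \<Rightarrow> 'f) \<Rightarrow> ('v, 'e) partial_map \<Rightarrow> ('w, 'f) partial_map" where
  "transport G f g \<phi> = (conj_map f (verts G) (fst \<phi>), conj_map g (edges G) (snd \<phi>))"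

lemma transport_in_carrier:
  assumes G: "graph G" and H: "graph H" and I: "graph_isomorphism G H f g"
    and \<phi>: "\<phi> \<in> fisg_carrier G"
  shows "transport G f g \<phi> \<in> fisg_carrier H"
proof -
  obtain m n where mn: "\<phi> = (m, n)" by (cases \<phi>)
  have m: "dom m \<subseteq> verts G" "ran m \<subseteq> verts G" "inj_on m (dom m)"
    and n: "dom n \<subseteq> edges G" "ran n \<subseteq> edges G" "inj_on n (dom n)"
    and ends: "\<And>e e'. n e = Some e' \<Longrightarrow> ends G e \<subseteq> dom m \<and> Some ` ends G e' = m ` ends G e"
    using \<phi> fisg_carrier_iff[OF G, of m n] by (auto simp: mn)
  have f: "inj_on f (verts G)" "f ` verts G = verts H" and g: "inj_on g (edges G)" "g ` edges G = edges H"
    using I by (auto simp: graph_isomorphism_def bij_betw_def)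
  have "ends H d \<subseteq> dom (conj_map f (verts G) m) \<and>
      Some ` ends H d' = conj_map f (verts G) m ` ends H d"
    if d: "conj_map g (edges G) n d = Some d'" for d d'
  proof -
    obtain e e' where e: "d = g e" "d' = g e'" "n e = Some e'"
      using d conj_map_eq_Some_iff[OF g(1) n(1)] by auto
    have E: "e \<in> edges G" "e' \<in> edges G" using e n by (auto simp: ran_def)
    have HG: "ends H d = f ` ends G e" "ends H d' = f ` ends G e'"
      using graph_isomorphism_ends[OF I G H] E e by auto
    \<comment> \<open>On endpoints of \<open>e\<close>, conjugating and then evaluating after
      \<open>f\<close> is the same as applying \<open>f\<close> to the value of \<open>m\<close>;
      the endpoint clause for \<open>n\<close> then identifies these values with the endpoints of
      \<open>d'\<close>.\<close>
    have "conj_map f (verts G) m ` f ` ends G e = map_option f ` m ` ends G e"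
      unfolding image_image
      using ends[OF e(3)] m(1) by (intro image_cong conj_map_apply[OF f(1)]) auto
    also have "\<dots> = Some ` f ` ends G e'"
      using ends[OF e(3)] by (metis (no_types, lifting) image_cong image_image option.map(2))
    finally show ?thesis
      using ends[OF e(3)] by (auto simp: HG dom_conj_map[OF f(1) m(1)])
  qed
  moreover have "dom (conj_map f (verts G) m) \<subseteq> verts H" "ran (conj_map f (verts G) m) \<subseteq> verts H"
    "dom (conj_map g (edges G) n) \<subseteq> edges H" "ran (conj_map g (edges G) n) \<subseteq> edges H"
    using m n f(2) g(2)
    unfolding dom_conj_map[OF f(1) m(1)] ran_conj_map[OF f(1) m(1)]
      dom_conj_map[OF g(1) n(1)] ran_conj_map[OF g(1) n(1)] by blast+
  ultimately show ?thesis
    using inj_on_conj_map[OF f(1) m] inj_on_conj_map[OF g(1) n]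
    by (simp add: transport_def mn fisg_carrier_iff[OF H])
qed

lemma transport_inverse:
  assumes G: "graph G" and I: "graph_isomorphism G H f g" and \<phi>: "\<phi> \<in> fisg_carrier G"
  shows "transport H (inv_into (verts G) f) (inv_into (edges G) g) (transport G f g \<phi>) = \<phi>"
  using I \<phi> fisg_carrier_iff[OF G, of "fst \<phi>" "snd \<phi>"]
  by (simp add: transport_def graph_isomorphism_def conj_map_inverse)

lemma Fisg_iso_if_graph_isomorphic:
  assumes G: "graph G" and H: "graph H" and "graph_isomorphic G H"
  shows "Fisg G \<cong> Fisg H"
proof -
  obtain f g where I: "graph_isomorphism G H f g"
    using assms(3) by (auto simp: graph_isomorphic_def)
  let ?T = "transport G f g"
  have fg: "inj_on f (verts G)" "inj_on g (edges G)"
    using I by (auto simp: graph_isomorphism_def bij_betw_def)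
  let ?T' = "transport H (inv_into (verts G) f) (inv_into (edges G) g)"
  note I' = graph_isomorphism_inv_into[OF I]
  have into: "?T ` fisg_carrier G \<subseteq> fisg_carrier H"
    using transport_in_carrier[OF G H I] by auto
  have inj: "inj_on ?T (fisg_carrier G)"
    by (rule inj_on_inverseI[of _ ?T']) (rule transport_inverse[OF G I])
  \<comment> \<open>Surjectivity of \<open>?T\<close> comes from injectivity of \<open>?T'\<close>:
    the elements \<open>?T (?T' \<psi>)\<close> and \<open>\<psi>\<close> have the same image under
    \<open>?T'\<close>. This avoids identifying a double \<open>inv_into\<close> with
    \<open>f\<close> or \<open>g\<close>.\<close>
  have "inj_on ?T' (fisg_carrier H)"
    by (rule inj_on_inverseI) (rule transport_inverse[OF H I'])
  then have "\<psi> = ?T (?T' \<psi>)" if "\<psi> \<in> fisg_carrier H" for \<psi>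
    using that transport_in_carrier[OF H G I'] transport_in_carrier[OF G H I] transport_inverse[OF G I]
    by (metis inj_onD)
  then have "fisg_carrier H \<subseteq> ?T ` fisg_carrier G"
    using transport_in_carrier[OF H G I'] by blast
  with into inj have "bij_betw ?T (fisg_carrier G) (fisg_carrier H)"
    by (auto simp: bij_betw_def)
  moreover have "?T (pcomp \<psi> \<phi>) = pcomp (?T \<psi>) (?T \<phi>)" if "\<phi> \<in> fisg_carrier G" for \<phi> \<psi>
    using that fisg_carrier_iff[OF G, of "fst \<phi>" "snd \<phi>"] fg
    by (simp add: transport_def pcomp_def conj_map_comp)
  ultimately have "?T \<in> iso (Fisg G) (Fisg H)"
    by (auto simp: iso_def hom_def Fisg_def bij_betw_def)
  then show ?thesis by (auto simp: is_iso_def)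
qed

theorem theorem5p1:
  fixes G :: "('v, 'e) ugraph" and H :: "('w, 'f) ugraph"
  assumes "graph G" and "graph H"
  shows "Fisg G \<cong> Fisg H \<longleftrightarrow> graph_isomorphic G H"
  using graph_isomorphic_if_Fisg_iso[OF assms] Fisg_iso_if_graph_isomorphic[OF assms] by blast

end
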